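(* Consider the ensemble of control systems in $\mathbb{R}^3$ $$\dot{x}=u,\quad \dot{y}=v,\quad \dot{z}^\theta=f^\theta(x)\,v,\qquad x(0)=y(0)=z^\theta(0)=0,\qquad \theta\in\Theta,$$ and put $a_m(\theta)=\frac{1}{m!}\left.\frac{\partial^m f^\theta}{\partial x^m}\right|_{x=0}$, $m=1,2,\dots$. The ensemble is time-$T$ approximately controllable for each $T>0$ if and only if the Lie algebraic span condition holds, i.e. $$\overline{\mathrm{span}}\{a_m(\theta),\ m=1,2,\dots\}=L_2(\Theta).$$
   Context: Standing assumptions: (i) the set of parameters $\Theta$ is a separable compact Hausdorff space equipped with a finite Borel measure, denoted $d\theta$; (ii) there is $\rho>0$ such that for each $\theta\in\Theta$ the real function $f^\theta(x)$, $x\in\mathbb{R}$, extends to a complex-analytic function on the complex $\rho$-neighborhood $B_\rho(\mathbb{R})$ of $\mathbb{R}$; (iii) for each $z\in B_\rho(\mathbb{R})$ the map $\theta\mapsto f^\theta(z)$ is continuous. The ensemble is called time-$T$ approximately controllable if for every target function $\hat z\in L_\infty(\Theta)$ and every $\varepsilon>0$ there exist $\theta$-independent controls $u(\cdot),v(\cdot)\in L_2[0,T]$ such that the trajectory driven by $u(\cdot),v(\cdot)$ satisfies $$x(T)=y(T)=0,\qquad \int_\Theta |z^\theta(T)-\hat z(\theta)|^2\,d\theta\le\varepsilon .$$ The closure $\overline{\mathrm{span}}$ is taken in $L_2(\Theta)$.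
   Formalization: Assumption (iii) is strengthened: the complex extension (θ,z) ↦ f^θ(z) is jointly continuous on Θ×B_ρ(ℝ), not only continuous in θ for each z; with separate continuity alone the a_m need not lie in L_2(Θ) and the equivalence can fail. *)

theory Defs
  imports "HOL-Complex_Analysis.Complex_Analysis"
begin

definition real_line_nbhd :: "real \<Rightarrow> complex set" where
  "real_line_nbhd \<rho> = (\<Union>x::real. ball (complex_of_real x) \<rho>)"

text \<open>
  \<open>L\<^sub>2\<close> and \<open>L\<^sub>\<infinity>\<close> are represented by real functions rather than by classes of almost
  everywhere equal functions. The closure below is saturated under a.e. equality.
\<close>

definition L2 :: "'a measure \<Rightarrow> ('a \<Rightarrow> real) set" where
  "L2 M = {g. g \<in> borel_measurable M \<and> integrable M (\<lambda>x. (g x)\<^sup>2)}"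

definition Linf :: "'a measure \<Rightarrow> ('a \<Rightarrow> real) set" where
  "Linf M = {g. g \<in> borel_measurable M \<and> (\<exists>C. AE x in M. \<bar>g x\<bar> \<le> C)}"

definition L2_norm :: "'a measure \<Rightarrow> ('a \<Rightarrow> real) \<Rightarrow> real" where
  "L2_norm M g = sqrt (integral\<^sup>L M (\<lambda>x. (g x)\<^sup>2))"

definition L2_closure :: "'a measure \<Rightarrow> ('a \<Rightarrow> real) set \<Rightarrow> ('a \<Rightarrow> real) set" where
  "L2_closure M S =
     {g \<in> L2 M. \<forall>\<epsilon>>0. \<exists>h \<in> S \<inter> L2 M. L2_norm M (\<lambda>x. h x - g x) < \<epsilon>}"

text \<open>The linear span in the space of all real functions, which carries no
  \<open>real_vector\<close> instance.\<close>

definition fun_span :: "('a \<Rightarrow> real) set \<Rightarrow> ('a \<Rightarrow> real) set" where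
  "fun_span S = {\<lambda>x. \<Sum>g\<in>A. c g * g x | A c. finite A \<and> A \<subseteq> S}"

text \<open>
  Caratheodory solutions on \<open>[0,T]\<close> of \<open>\<xi>' = g\<close>, i.e. absolutely continuous functions
  satisfying the equation almost everywhere, in the equivalent form of Lebesgue primitives
  of an integrable \<open>g\<close>. Controls are only square integrable, so a classical derivative
  cannot be required.
\<close>

definition solves_ae :: "real \<Rightarrow> (real \<Rightarrow> real) \<Rightarrow> (real \<Rightarrow> real) \<Rightarrow> bool" where
  "solves_ae T \<xi> g \<longleftrightarrow> integrable (lebesgue_on {0..T}) g \<and>
     (\<forall>t\<in>{0..T}. \<xi> t - \<xi> 0 = integral\<^sup>L (lebesgue_on {0..t}) g)"

definition ensemble_trajectory ::
  "('p \<Rightarrow> real \<Rightarrow> real) \<Rightarrow> real \<Rightarrow> (real \<Rightarrow> real) \<Rightarrow> (real \<Rightarrow> real) \<Rightarrow>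
   (real \<Rightarrow> real) \<Rightarrow> (real \<Rightarrow> real) \<Rightarrow> ('p \<Rightarrow> real \<Rightarrow> real) \<Rightarrow> bool" where
  "ensemble_trajectory f T u v x y z \<longleftrightarrow>
     x 0 = 0 \<and> y 0 = 0 \<and> (\<forall>\<theta>. z \<theta> 0 = 0) \<and>
     solves_ae T x u \<and> solves_ae T y v \<and>
     (\<forall>\<theta>. solves_ae T (z \<theta>) (\<lambda>t. f \<theta> (x t) * v t))"

definition approx_controllable ::
  "'p measure \<Rightarrow> ('p \<Rightarrow> real \<Rightarrow> real) \<Rightarrow> real \<Rightarrow> bool" where
  "approx_controllable \<mu> f T \<longleftrightarrow>
     (\<forall>zh \<in> Linf \<mu>. \<forall>\<epsilon>>0.
        \<exists>u \<in> L2 (lebesgue_on {0..T}). \<exists>v \<in> L2 (lebesgue_on {0..T}). \<exists>x y z.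
          ensemble_trajectory f T u v x y z \<and> x T = 0 \<and> y T = 0 \<and>
          (\<lambda>\<theta>. z \<theta> T - zh \<theta>) \<in> L2 \<mu> \<and>
          integral\<^sup>L \<mu> (\<lambda>\<theta>. (z \<theta> T - zh \<theta>)\<^sup>2) \<le> \<epsilon>)"

definition taylor_coeff :: "('p \<Rightarrow> real \<Rightarrow> real) \<Rightarrow> nat \<Rightarrow> 'p \<Rightarrow> real" where
  "taylor_coeff f m \<theta> = (deriv ^^ m) (f \<theta>) 0 / fact m"

text \<open>
  The complex extensions are required to be jointly continuous on \<open>\<Theta> \<times> B\<^sub>\<rho>(\<real>)\<close>. For a family
  that is analytic in \<open>z\<close> and continuous in \<open>\<theta>\<close> for each fixed \<open>z\<close>, over compact \<open>\<Theta>\<close>, this amounts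
  to boundedness on \<open>\<Theta> \<times> K\<close> for every compact \<open>K\<close> in \<open>B\<^sub>\<rho>(\<real>)\<close>. Separate continuity alone
  does not give it (pointwise limits of polynomials need not be locally uniform), and without it
  the Taylor coefficients need not be continuous in \<open>\<theta>\<close>, nor even belong to \<open>L\<^sub>2(\<Theta>)\<close>.
\<close>

definition analytic_ensemble :: "real \<Rightarrow> ('p::topological_space \<Rightarrow> real \<Rightarrow> real) \<Rightarrow> bool" where
  "analytic_ensemble \<rho> f \<longleftrightarrow>
     (\<exists>F :: 'p \<Rightarrow> complex \<Rightarrow> complex.
        (\<forall>\<theta>. F \<theta> analytic_on real_line_nbhd \<rho>) \<and>
        (\<forall>\<theta> x. F \<theta> (complex_of_real x) = complex_of_real (f \<theta> x)) \<and>
        continuous_on (UNIV \<times> real_line_nbhd \<rho>) (\<lambda>(\<theta>, z). F \<theta> z))"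

end

theory Submission
  imports Defs
begin

text \<open>
  Write \<open>a\<^sub>m\<close> for the Taylor coefficients at \<open>0\<close>, and call \<open>\<theta> \<mapsto> f\<^sup>\<theta>(x) - f\<^sup>\<theta>(0)\<close>, for real \<open>x\<close>, the
  increments. The increments are the bridge between control and Taylor coefficients, and everything
  apart from the final density statement happens in the uniform norm over \<open>\<Theta>\<close>.

  Controls and increments. Traversing a rectangle with sides parallel to the axes, from \<open>(0,0)\<close> over
  \<open>(x,0)\<close>, \<open>(x,k)\<close> and \<open>(0,k)\<close> back to \<open>(0,0)\<close>, changes \<open>z\<^sup>\<theta>\<close> by exactly \<open>k (f\<^sup>\<theta>(x) - f\<^sup>\<theta>(0))\<close>, and it
  may be done arbitrarily fast. Concatenating rectangles reaches every linear combination of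
  increments, in any time (\<open>steers_fun_span_increments\<close>). Conversely, for a loop the controls satisfy
  \<open>\<integral> v = y(T) = 0\<close>, so that \<open>z\<^sup>\<theta>(T) = \<integral> (f\<^sup>\<theta>(x(t)) - f\<^sup>\<theta>(0)) v(t) dt\<close>; replacing \<open>x(t)\<close> by the nearest
  lower point of a fine grid shows that this is a uniform limit of linear combinations of increments
  (\<open>reachable_in_uniform_span_increments\<close>). So the reachable functions and the span of the increments
  have the same closure.

  Increments and Taylor coefficients. Joint continuity of the complex extensions and compactness of
  \<open>\<Theta>\<close> bound them on \<open>\<Theta> \<times> K\<close> for compact \<open>K\<close>, so Cauchy's inequality makes Taylor's formula uniform in
  \<open>\<theta>\<close>. Hence \<open>a\<^sub>m\<close> is the uniform limit, as \<open>h\<close> tends to \<open>0\<close>, of the increment at \<open>h\<close> with its terms of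
  order below \<open>m\<close> removed and divided by \<open>h\<^sup>m\<close> (\<open>coeff_in_uniform_span_increments\<close>). In the
  other direction the Taylor series recovers the increments only near \<open>0\<close>; but the radius of
  convergence at every real point is at least \<open>\<rho>\<close>, so one can continue analytically along the real line in steps of
  fixed length and reach every increment (\<open>increment_in_uniform_span_coeffs\<close>).

  Thus the reachable functions, the increments and the \<open>a\<^sub>m\<close> generate the same closed subspace of
  \<open>L\<^sub>2(\<Theta>)\<close>, and since \<open>L\<^sub>\<infinity>(\<Theta>)\<close> is dense in \<open>L\<^sub>2(\<Theta>)\<close>, approximating all bounded targets amounts to
  this subspace being \<open>L\<^sub>2(\<Theta>)\<close>.
\<close>

section \<open>Uniform closures of linear spans\<close>

lemma fun_span_0: "(\<lambda>x. 0) \<in> fun_span S"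
  unfolding fun_span_def by (rule CollectI, rule exI[of _ "{}"]) auto

lemma fun_span_base: "g \<in> S \<Longrightarrow> g \<in> fun_span S"
  unfolding fun_span_def by (rule CollectI, rule exI[of _ "{g}"], rule exI[of _ "\<lambda>_. 1"]) auto

lemma fun_span_scale:
  assumes "g \<in> fun_span S" shows "(\<lambda>x. a * g x) \<in> fun_span S"
proof -
  obtain A c where A: "finite A" "A \<subseteq> S" "g = (\<lambda>x. \<Sum>h\<in>A. c h * h x)"
    using assms unfolding fun_span_def by auto
  have "(\<lambda>x. a * g x) = (\<lambda>x. \<Sum>h\<in>A. (a * c h) * h x)"
    by (simp add: A(3) sum_distrib_left mult.assoc)
  then show ?thesis
    using A unfolding fun_span_def by (intro CollectI exI[of _ A] exI[of _ "\<lambda>h. a * c h"]) auto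
qed

lemma fun_span_add:
  assumes "g \<in> fun_span S" "h \<in> fun_span S" shows "(\<lambda>x. g x + h x) \<in> fun_span S"
proof -
  obtain A c where A: "finite A" "A \<subseteq> S" "g = (\<lambda>x. \<Sum>k\<in>A. c k * k x)"
    using assms unfolding fun_span_def by auto
  obtain B d where B: "finite B" "B \<subseteq> S" "h = (\<lambda>x. \<Sum>k\<in>B. d k * k x)"
    using assms unfolding fun_span_def by auto
  let ?e = "\<lambda>k. (if k \<in> A then c k else 0) + (if k \<in> B then d k else 0)"
  have "(\<lambda>x. g x + h x) = (\<lambda>x. \<Sum>k\<in>A\<union>B. ?e k * k x)"
  proof
    fix x
    have "g x = (\<Sum>k\<in>A\<union>B. (if k \<in> A then c k else 0) * k x)"
      unfolding A(3) using A(1) B(1) by (intro sum.mono_neutral_cong_left) auto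
    moreover have "h x = (\<Sum>k\<in>A\<union>B. (if k \<in> B then d k else 0) * k x)"
      unfolding B(3) using A(1) B(1) by (intro sum.mono_neutral_cong_left) auto
    ultimately show "g x + h x = (\<Sum>k\<in>A\<union>B. ?e k * k x)"
      by (simp add: sum.distrib distrib_right)
  qed
  then show ?thesis
    using A B unfolding fun_span_def by (intro CollectI exI[of _ "A \<union> B"] exI[of _ ?e]) auto
qed

text \<open>
  The span is described by finite sets of functions with coefficients attached; adding one multiple
  at a time is the form in which it is used, for closure properties and for concatenating loops.
\<close>

lemma fun_span_induct [consumes 1, case_names zero add]:
  assumes "g \<in> fun_span S"
    and zero: "P (\<lambda>x. 0)"
    and add: "\<And>a h g. h \<in> S \<Longrightarrow> P g \<Longrightarrow> P (\<lambda>x. a * h x + g x)"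
  shows "P g"
proof -
  obtain A c where A: "finite A" "A \<subseteq> S" "g = (\<lambda>x. \<Sum>k\<in>A. c k * k x)"
    using assms unfolding fun_span_def by auto
  have "P (\<lambda>x. \<Sum>k\<in>A. c k * k x)"
    using A(1,2) by (induction A rule: finite_induct) (auto intro: zero add)
  then show ?thesis by (simp add: A(3))
qed

text \<open>
  The limits are uniform on the whole type and refer to no measure, so that passing to \<open>L\<^sub>2\<close> closures
  can be postponed to a single comparison, \<open>uniform_span_subset_L2_closure\<close>.
\<close>

definition uniform_span :: "('a \<Rightarrow> real) set \<Rightarrow> ('a \<Rightarrow> real) set" where
  "uniform_span S = {g. \<forall>\<epsilon>>0. \<exists>h\<in>fun_span S. \<forall>x. \<bar>h x - g x\<bar> \<le> \<epsilon>}"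

lemma uniform_span_superset: "fun_span S \<subseteq> uniform_span S"
proof
  fix g assume "g \<in> fun_span S"
  then show "g \<in> uniform_span S"
    unfolding uniform_span_def by (intro CollectI allI impI bexI[of _ g]) simp_all
qed

lemma uniform_span_0: "(\<lambda>x. 0) \<in> uniform_span S"
  using uniform_span_superset fun_span_0 by blast

lemma uniform_span_base: "g \<in> S \<Longrightarrow> g \<in> uniform_span S"
  using uniform_span_superset fun_span_base by blast

lemma uniform_span_closed:
  assumes "\<And>\<epsilon>. \<epsilon> > 0 \<Longrightarrow> \<exists>h\<in>uniform_span S. \<forall>x. \<bar>h x - g x\<bar> \<le> \<epsilon>"
  shows "g \<in> uniform_span S"
  unfolding uniform_span_def
proof (intro CollectI allI impI)
  fix \<epsilon> :: real assume "\<epsilon> > 0"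
  then obtain h where h: "h \<in> uniform_span S" "\<And>x. \<bar>h x - g x\<bar> \<le> \<epsilon>/2"
    using assms[of "\<epsilon>/2"] by auto
  obtain k where k: "k \<in> fun_span S" "\<And>x. \<bar>k x - h x\<bar> \<le> \<epsilon>/2"
    using h(1) \<open>\<epsilon> > 0\<close> unfolding uniform_span_def by (auto dest!: spec[of _ "\<epsilon>/2"])
  have "\<bar>k x - g x\<bar> \<le> \<epsilon>" for x using h(2)[of x] k(2)[of x] by linarith
  then show "\<exists>h\<in>fun_span S. \<forall>x. \<bar>h x - g x\<bar> \<le> \<epsilon>" using k(1) by blast
qed

lemma uniform_span_add:
  assumes "g \<in> uniform_span S" "h \<in> uniform_span S"
  shows "(\<lambda>x. g x + h x) \<in> uniform_span S"
  unfolding uniform_span_def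
proof (intro CollectI allI impI)
  fix \<epsilon> :: real assume "\<epsilon> > 0"
  then obtain g' h' where g': "g' \<in> fun_span S" "\<And>x. \<bar>g' x - g x\<bar> \<le> \<epsilon>/2"
    and h': "h' \<in> fun_span S" "\<And>x. \<bar>h' x - h x\<bar> \<le> \<epsilon>/2"
    using assms unfolding uniform_span_def by (auto dest!: spec[of _ "\<epsilon>/2"])
  have "\<bar>(g' x + h' x) - (g x + h x)\<bar> \<le> \<epsilon>" for x using g'(2)[of x] h'(2)[of x] by linarith
  then show "\<exists>k\<in>fun_span S. \<forall>x. \<bar>k x - (g x + h x)\<bar> \<le> \<epsilon>"
    using fun_span_add[OF g'(1) h'(1)] by (intro bexI[of _ "\<lambda>x. g' x + h' x"]) simp_all
qed

lemma uniform_span_scale: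
  assumes "g \<in> uniform_span S"
  shows "(\<lambda>x. a * g x) \<in> uniform_span S"
  unfolding uniform_span_def
proof (intro CollectI allI impI)
  fix \<epsilon> :: real assume "\<epsilon> > 0"
  define \<delta> where "\<delta> = \<epsilon> / (\<bar>a\<bar> + 1)"
  have "\<delta> > 0" using \<open>\<epsilon> > 0\<close> by (simp add: \<delta>_def)
  then obtain g' where g': "g' \<in> fun_span S" "\<And>x. \<bar>g' x - g x\<bar> \<le> \<delta>"
    using assms unfolding uniform_span_def by (auto dest!: spec[of _ \<delta>])
  have "\<bar>a * g' x - a * g x\<bar> \<le> \<epsilon>" for x
  proof -
    have "\<bar>a * g' x - a * g x\<bar> = \<bar>a\<bar> * \<bar>g' x - g x\<bar>" by (simp add: abs_mult flip: right_diff_distrib)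
    also have "\<dots> \<le> (\<bar>a\<bar> + 1) * \<delta>" using g'(2)[of x] by (intro mult_mono) auto
    also have "\<dots> = \<epsilon>" by (simp add: \<delta>_def)
    finally show ?thesis .
  qed
  then show "\<exists>k\<in>fun_span S. \<forall>x. \<bar>k x - a * g x\<bar> \<le> \<epsilon>"
    using fun_span_scale[OF g'(1)] by (intro bexI[of _ "\<lambda>x. a * g' x"]) simp_all
qed

lemma uniform_span_diff:
  assumes "g \<in> uniform_span S" "h \<in> uniform_span S"
  shows "(\<lambda>x. g x - h x) \<in> uniform_span S"
  using uniform_span_add[OF assms(1) uniform_span_scale[OF assms(2), of "-1"]] by simp

lemma uniform_span_sum:
  assumes "\<And>i. i \<in> I \<Longrightarrow> g i \<in> uniform_span S"
  shows "(\<lambda>x. \<Sum>i\<in>I. g i x) \<in> uniform_span S"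
  using assms by (induction I rule: infinite_finite_induct)
    (auto intro!: uniform_span_0 uniform_span_add)

lemma fun_span_subset_uniform_span:
  assumes "S \<subseteq> uniform_span S'" shows "fun_span S \<subseteq> uniform_span S'"
proof
  fix g assume "g \<in> fun_span S"
  then show "g \<in> uniform_span S'"
    using assms by (induction rule: fun_span_induct)
      (auto intro!: uniform_span_0 uniform_span_add uniform_span_scale)
qed

lemma continuous_on_uniform_span:
  fixes S :: "('a::topological_space \<Rightarrow> real) set"
  assumes "\<And>g. g \<in> S \<Longrightarrow> continuous_on UNIV g" "g \<in> uniform_span S"
  shows "continuous_on UNIV g"
proof -
  have span: "continuous_on UNIV h" if "h \<in> fun_span S" for h
    using that by (induction rule: fun_span_induct) (simp_all add: assms(1) continuous_on_add continuous_on_mult_left)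
  have "\<exists>h. h \<in> fun_span S \<and> (\<forall>x. \<bar>h x - g x\<bar> \<le> 1 / real (Suc n))" for n
    using assms(2) unfolding uniform_span_def by (auto dest!: spec[of _ "1 / real (Suc n)"])
  then obtain h where h: "\<And>n. h n \<in> fun_span S" "\<And>n x. \<bar>h n x - g x\<bar> \<le> 1 / real (Suc n)"
    by metis
  show ?thesis
  proof (rule uniform_limit_theorem[of _ h sequentially])
    show "\<forall>\<^sub>F n in sequentially. continuous_on UNIV (h n)"
      using span h(1) by simp
    show "uniform_limit UNIV h g sequentially"
    proof (rule uniform_limitI)
      fix e :: real assume "e > 0"
      then have "\<forall>\<^sub>F n in sequentially. 1 / real (Suc n) < e"
        by (intro order_tendstoD(2)[OF LIMSEQ_Suc[OF lim_1_over_n]])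
      then show "\<forall>\<^sub>F n in sequentially. \<forall>x\<in>UNIV. dist (h n x) (g x) < e"
        by eventually_elim (use h(2) in \<open>auto simp: dist_real_def intro: le_less_trans\<close>)
    qed
  qed auto
qed

section \<open>Families with uniform Taylor estimates\<close>

text \<open>
  Cauchy's inequality bounds the \<open>m\<close>-th term of the Taylor series by \<open>B q\<^sup>m\<close> with \<open>q = |h| / s\<close>, and
  for \<open>q \<le> 1/2\<close> the tail of this geometric series from \<open>N\<close> on is at most \<open>2 B q\<^sup>N\<close>.
\<close>

lemma taylor_remainder_le:
  fixes F :: "complex \<Rightarrow> complex"
  assumes hol: "F holomorphic_on ball z s" and cont: "continuous_on (cball z s) F"
    and B: "\<And>w. w \<in> cball z s \<Longrightarrow> norm (F w) \<le> B"
    and s: "s > 0" and h: "norm h \<le> s / 2"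
  shows "norm (F (z + h) - (\<Sum>m<N. (deriv ^^ m) F z / fact m * h ^ m)) \<le> 2 * B * (norm h / s) ^ N"
proof -
  define q where "q = norm h / s"
  define a where "a = (\<lambda>m. (deriv ^^ m) F z / fact m * h ^ m)"
  have q: "0 \<le> q" "q \<le> 1/2" using s h by (auto simp: q_def field_simps)
  have B0: "0 \<le> B" using order_trans[OF norm_ge_zero B[of z]] s by simp
  have sums: "a sums F (z + h)"
    using holomorphic_power_series[OF hol, of "z + h"] s h by (auto simp: a_def dist_norm)
  have le: "norm (a m) \<le> B * q ^ m" for m
  proof -
    have "norm ((deriv ^^ m) F z) \<le> fact m * B / s ^ m"
      using B s by (intro Cauchy_inequality[OF hol cont]) (auto simp: dist_norm)
    then have "norm ((deriv ^^ m) F z) / fact m \<le> B / s ^ m" by (simp add: field_simps)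
    then have "norm ((deriv ^^ m) F z) / fact m * norm h ^ m \<le> B / s ^ m * norm h ^ m"
      by (rule mult_right_mono) simp
    then show ?thesis by (simp add: a_def q_def norm_mult norm_divide norm_power power_divide)
  qed
  have g: "(\<lambda>m. B * q ^ N * q ^ m) sums (B * q ^ N * (1 / (1 - q)))"
    using q by (intro sums_mult geometric_sums) auto
  have "norm (\<Sum>m. a (m + N)) \<le> (\<Sum>m. B * q ^ N * q ^ m)"
  proof (rule norm_suminf_le)
    show "norm (a (m + N)) \<le> B * q ^ N * q ^ m" for m
      using le[of "m + N"] by (simp add: power_add mult_ac)
  qed (use g in \<open>simp add: sums_iff\<close>)
  also have "\<dots> = B * q ^ N * (1 / (1 - q))" using g by (simp add: sums_iff)
  also have "\<dots> \<le> B * q ^ N * 2"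
    using q B0 by (intro mult_left_mono) (auto simp: field_simps)
  also have "(\<Sum>m. a (m + N)) = F (z + h) - (\<Sum>m<N. a m)"
    using suminf_minus_initial_segment[of a N] sums by (simp add: sums_iff)
  finally show ?thesis by (simp add: a_def q_def mult_ac)
qed

lemma open_real_line_nbhd: "open (real_line_nbhd \<rho>)"
  unfolding real_line_nbhd_def by auto

lemma of_real_in_real_line_nbhd: "\<rho> > 0 \<Longrightarrow> complex_of_real x \<in> real_line_nbhd \<rho>"
  unfolding real_line_nbhd_def by (auto intro!: exI[of _ x])

text \<open>
  The coefficients \<open>a\<^sub>m\<close> are iterated real derivatives while Cauchy's inequality speaks of complex ones.
  Restricted to the real axis the complex derivative is the derivative along the axis of a
  real-valued function, so both agree at each order.
\<close>

lemma higher_deriv_of_real: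
  fixes f :: "real \<Rightarrow> real" and F :: "complex \<Rightarrow> complex"
  assumes hol: "F holomorphic_on U" "open U" "\<And>x. complex_of_real x \<in> U"
    and eq: "\<And>x. F (of_real x) = of_real (f x)"
  shows "(deriv ^^ m) F (of_real x) = of_real ((deriv ^^ m) f x)"
proof (induction m arbitrary: x)
  case (Suc m)
  let ?G = "(deriv ^^ m) F" and ?g = "(deriv ^^ m) f"
  have "?G holomorphic_on U" using hol by (intro holomorphic_higher_deriv) auto
  then have "(?G has_field_derivative deriv ?G (of_real x)) (at (of_real x))"
    using hol by (intro holomorphic_derivI[of _ U]) auto
  then have *: "((\<lambda>t. ?G (of_real t)) has_vector_derivative deriv ?G (of_real x)) (at x)"
    by (rule has_vector_derivative_real_field)
  then have v: "((\<lambda>t. complex_of_real (?g t)) has_vector_derivative deriv ?G (of_real x)) (at x)"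
    by (simp add: Suc.IH)
  have "((\<lambda>t. Re (complex_of_real (?g t))) has_vector_derivative Re (deriv ?G (of_real x))) (at x)"
    using bounded_linear.has_vector_derivative[OF bounded_linear_Re v] .
  then have re: "deriv ?g x = Re (deriv ?G (of_real x))"
    by (intro DERIV_imp_deriv) (simp add: has_real_derivative_iff_has_vector_derivative)
  have "((\<lambda>t. Im (complex_of_real (?g t))) has_vector_derivative Im (deriv ?G (of_real x))) (at x)"
    using bounded_linear.has_vector_derivative[OF bounded_linear_Im v] .
  then have "((\<lambda>t. 0::real) has_vector_derivative Im (deriv ?G (of_real x))) (at x)" by simp
  then have "Im (deriv ?G (of_real x)) = 0"
    using vector_derivative_unique_at has_vector_derivative_const by blast
  then show ?case using re by (simp add: complex_eq_iff)
qed (use eq in simp)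

text \<open>
  Taylor's formula with a remainder that is uniform in the parameter and in base points from a
  bounded interval, and with a common radius \<open>r\<close>. The scale \<open>2 * r\<close> keeps
  the ratio of the remainder bounds at most \<open>1/2\<close> on the whole range \<open>|h| \<le> r\<close>.
\<close>

locale taylor_family =
  fixes f :: "'p \<Rightarrow> real \<Rightarrow> real" and c :: "nat \<Rightarrow> real \<Rightarrow> 'p \<Rightarrow> real" and r :: real
  assumes r_pos: "r > 0"
    and taylor: "\<And>R. \<exists>M\<ge>0. \<forall>\<theta> x h N. \<bar>x\<bar> \<le> R \<longrightarrow> \<bar>h\<bar> \<le> r \<longrightarrow>
                   \<bar>f \<theta> (x + h) - (\<Sum>m<N. c m x \<theta> * h ^ m)\<bar> \<le> M * (\<bar>h\<bar> / (2 * r)) ^ N"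
begin

lemma coeff_0: "c 0 x \<theta> = f \<theta> x"
proof -
  obtain M where "\<forall>\<theta> y h N. \<bar>y\<bar> \<le> \<bar>x\<bar> \<longrightarrow> \<bar>h\<bar> \<le> r \<longrightarrow>
      \<bar>f \<theta> (y + h) - (\<Sum>m<N. c m y \<theta> * h ^ m)\<bar> \<le> M * (\<bar>h\<bar> / (2 * r)) ^ N"
    using taylor[of "\<bar>x\<bar>"] by auto
  from this[rule_format, where \<theta> = \<theta> and y = x and h = 0 and N = 1] show ?thesis
    using r_pos by simp
qed

lemma increment_estimate:
  "\<exists>M\<ge>0. \<forall>\<theta> h N. \<bar>h\<bar> \<le> r \<longrightarrow>
     \<bar>(f \<theta> (x + h) - f \<theta> x) - (\<Sum>m=1..<Suc N. c m x \<theta> * h ^ m)\<bar> \<le> M * (\<bar>h\<bar> / (2 * r)) ^ Suc N"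
proof -
  obtain M where M: "M \<ge> 0" "\<And>\<theta> h N. \<bar>h\<bar> \<le> r \<Longrightarrow>
      \<bar>f \<theta> (x + h) - (\<Sum>m<N. c m x \<theta> * h ^ m)\<bar> \<le> M * (\<bar>h\<bar> / (2 * r)) ^ N"
    using taylor[of "\<bar>x\<bar>"] by auto
  have "(\<Sum>m<Suc N. c m x \<theta> * h ^ m) = f \<theta> x + (\<Sum>m=1..<Suc N. c m x \<theta> * h ^ m)" for \<theta> h N
    by (simp add: lessThan_atLeast0 sum.atLeast_Suc_lessThan coeff_0 del: sum.op_ivl_Suc)
  then show ?thesis
    using M(1) M(2)[where N = "Suc _"] by (intro exI[of _ M]) (auto simp: diff_diff_eq simp del: power_Suc sum.op_ivl_Suc sum.lessThan_Suc)
qed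

text \<open>
  Close to \<open>x\<close> the Taylor series converges uniformly in the parameter.
\<close>

lemma increment_in_uniform_span:
  assumes c: "\<And>m. m \<ge> 1 \<Longrightarrow> c m x \<in> uniform_span S" and h: "\<bar>h\<bar> \<le> r"
  shows "(\<lambda>\<theta>. f \<theta> (x + h) - f \<theta> x) \<in> uniform_span S"
proof (rule uniform_span_closed)
  fix \<epsilon> :: real assume "\<epsilon> > 0"
  obtain M where M: "M \<ge> 0" "\<And>\<theta> N. \<bar>(f \<theta> (x + h) - f \<theta> x) - (\<Sum>m=1..<Suc N. c m x \<theta> * h ^ m)\<bar>
      \<le> M * (\<bar>h\<bar> / (2 * r)) ^ Suc N"
    using increment_estimate[of x] h by (elim exE conjE) simp
  have "\<bar>h\<bar> / (2 * r) < 1" "0 \<le> \<bar>h\<bar> / (2 * r)"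
    using h r_pos by (simp_all add: divide_less_eq)
  then have "(\<lambda>N. M * (\<bar>h\<bar> / (2 * r)) ^ Suc N) \<longlonglongrightarrow> M * 0"
    by (intro tendsto_mult_left LIMSEQ_Suc[OF LIMSEQ_realpow_zero])
  then have "\<forall>\<^sub>F N in sequentially. M * (\<bar>h\<bar> / (2 * r)) ^ Suc N < \<epsilon>"
    using \<open>\<epsilon> > 0\<close> by (intro order_tendstoD(2)) auto
  then obtain N where N: "M * (\<bar>h\<bar> / (2 * r)) ^ Suc N < \<epsilon>"
    by (auto simp: eventually_sequentially)
  have "(\<lambda>\<theta>. \<Sum>m=1..<Suc N. h ^ m * c m x \<theta>) \<in> uniform_span S"
    by (intro uniform_span_sum uniform_span_scale c) auto
  then have "(\<lambda>\<theta>. \<Sum>m=1..<Suc N. c m x \<theta> * h ^ m) \<in> uniform_span S"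
    by (simp add: mult.commute)
  moreover have "\<bar>(\<Sum>m=1..<Suc N. c m x \<theta> * h ^ m) - (f \<theta> (x + h) - f \<theta> x)\<bar> \<le> \<epsilon>" for \<theta>
    using M(2)[of \<theta> N] N by (subst abs_minus_commute) linarith
  ultimately show "\<exists>g\<in>uniform_span S. \<forall>\<theta>. \<bar>g \<theta> - (f \<theta> (x + h) - f \<theta> x)\<bar> \<le> \<epsilon>"
      by (intro bexI allI)
qed

text \<open>
  By induction on \<open>m\<close>: once the lower coefficients are available, subtract their terms from the
  increment and divide by \<open>h\<^sup>m\<close>. What remains is the \<open>m\<close>-th coefficient up to an error of order \<open>h\<close>.
\<close>

lemma coeff_in_uniform_span:
  assumes \<delta>: "\<delta> > 0" and incr: "\<And>h. \<bar>h\<bar> \<le> \<delta> \<Longrightarrow> (\<lambda>\<theta>. f \<theta> (x + h) - f \<theta> x) \<in> uniform_span S"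
    and "m \<ge> 1"
  shows "c m x \<in> uniform_span S"
  using \<open>m \<ge> 1\<close>
proof (induction m rule: less_induct)
  case (less m)
  obtain M where M: "M \<ge> 0" "\<And>\<theta> h N. \<bar>h\<bar> \<le> r \<Longrightarrow>
      \<bar>(f \<theta> (x + h) - f \<theta> x) - (\<Sum>m=1..<Suc N. c m x \<theta> * h ^ m)\<bar> \<le> M * (\<bar>h\<bar> / (2 * r)) ^ Suc N"
    using increment_estimate[of x] by (elim exE conjE) simp
  show ?case
  proof (rule uniform_span_closed)
    fix \<epsilon> :: real assume "\<epsilon> > 0"
    \<comment> \<open>After division by \<open>h\<^sup>m\<close> the remainder bound is \<open>K h\<close>, which dictates the choice of \<open>h\<close>.\<close>
    define K where "K = M / (2 * r) ^ Suc m"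
    have "K \<ge> 0" using M(1) r_pos by (simp add: K_def)
    define h where "h = min (min \<delta> r) (\<epsilon> / (K + 1))"
    have h: "h > 0" "\<bar>h\<bar> \<le> \<delta>" "\<bar>h\<bar> \<le> r" "h \<le> \<epsilon> / (K + 1)"
      using \<delta> r_pos \<open>\<epsilon> > 0\<close> \<open>K \<ge> 0\<close> by (auto simp: h_def)
    have Kh: "K * h \<le> \<epsilon>"
    proof -
      have "K * h \<le> (K + 1) * (\<epsilon> / (K + 1))" using h \<open>K \<ge> 0\<close> by (intro mult_mono) auto
      then show ?thesis using \<open>K \<ge> 0\<close> by simp
    qed
    let ?g = "\<lambda>\<theta>. (1 / h ^ m) * ((f \<theta> (x + h) - f \<theta> x) - (\<Sum>k=1..<m. h ^ k * c k x \<theta>))"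
    have "?g \<in> uniform_span S"
      using less.IH
      by (intro uniform_span_scale uniform_span_diff incr h uniform_span_sum) auto
    moreover have "\<bar>?g \<theta> - c m x \<theta>\<bar> \<le> \<epsilon>" for \<theta>
    proof -
      have "?g \<theta> - c m x \<theta> = (1 / h ^ m) *
          ((f \<theta> (x + h) - f \<theta> x) - (\<Sum>k=1..<Suc m. c k x \<theta> * h ^ k))"
        using h(1) less.prems by (simp add: field_simps)
      then have "\<bar>?g \<theta> - c m x \<theta>\<bar> \<le> (1 / h ^ m) * (M * (\<bar>h\<bar> / (2 * r)) ^ Suc m)"
        using M(2)[OF h(3), of \<theta> m] h(1) by (simp add: abs_mult divide_right_mono del: power_Suc)
      also have "\<dots> = K * h"
        using h(1) by (simp add: K_def power_divide)
      finally show ?thesis using Kh by linarith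
    qed
    ultimately show "\<exists>g\<in>uniform_span S. \<forall>\<theta>. \<bar>g \<theta> - c m x \<theta>\<bar> \<le> \<epsilon>"
      by (intro bexI[of _ ?g] allI)
  qed
qed

lemma coeff_in_uniform_span_increments:
  "m \<ge> 1 \<Longrightarrow> c m 0 \<in> uniform_span {\<lambda>\<theta>. f \<theta> x - f \<theta> 0 | x. True}"
  by (rule coeff_in_uniform_span[of 1]) (auto intro!: uniform_span_base)

text \<open>
  Analytic continuation along the real line, in steps of length \<open>r/2\<close>. If the closed subspace contains all
  coefficients at \<open>y\<close>, it contains the increments from \<open>y\<close> to all points within distance \<open>r\<close>, hence the differences
  \<open>f(x + h) - f(x)\<close> for \<open>x\<close> within \<open>r/2\<close> of \<open>y\<close> and small \<open>h\<close>, and hence the coefficients at \<open>x\<close>.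
\<close>

lemma increment_in_uniform_span_coeffs:
  "(\<lambda>\<theta>. f \<theta> x - f \<theta> 0) \<in> uniform_span {c m 0 | m. m \<ge> 1}" (is "_ \<in> ?U")
proof -
  have "(\<lambda>\<theta>. f \<theta> x - f \<theta> 0) \<in> ?U \<and> (\<forall>m\<ge>1. c m x \<in> ?U)" if "\<bar>x\<bar> \<le> real n * (r / 2)" for n x
    using that
  proof (induction n arbitrary: x)
    case 0
    then show ?case by (auto intro!: uniform_span_0 uniform_span_base)
  next
    case (Suc n)
    obtain y where y: "\<bar>y\<bar> \<le> real n * (r / 2)" "\<bar>x - y\<bar> \<le> r / 2"
    proof
      define b where "b = real n * (r / 2)"
      \<comment> \<open>Clamp \<open>x\<close> to the interval that is already covered.\<close>
      let ?y = "max (- b) (min b x)"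
      have b: "0 \<le> b" "\<bar>x\<bar> \<le> b + r / 2"
        using r_pos Suc.prems by (simp_all add: b_def distrib_right)
      have "\<bar>?y\<bar> \<le> b" using b by linarith
      then show "\<bar>?y\<bar> \<le> real n * (r / 2)" by (simp only: b_def)
      show "\<bar>x - ?y\<bar> \<le> r / 2" using b r_pos by linarith
    qed
    have IH: "(\<lambda>\<theta>. f \<theta> y - f \<theta> 0) \<in> ?U" "\<And>m. m \<ge> 1 \<Longrightarrow> c m y \<in> ?U"
      using Suc.IH[OF y(1)] by auto
    have near: "(\<lambda>\<theta>. f \<theta> (y + h) - f \<theta> y) \<in> ?U" if "\<bar>h\<bar> \<le> r" for h
      using increment_in_uniform_span[OF IH(2) that] .
    have x: "(\<lambda>\<theta>. f \<theta> x - f \<theta> y) \<in> ?U"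
      using near[of "x - y"] y(2) r_pos by simp
    have "(\<lambda>\<theta>. f \<theta> (x + h) - f \<theta> x) \<in> ?U" if "\<bar>h\<bar> \<le> r / 2" for h
    proof -
      have "(\<lambda>\<theta>. f \<theta> (y + (x + h - y)) - f \<theta> y) \<in> ?U"
        using that y(2) by (intro near) linarith
      from uniform_span_diff[OF this x] show ?thesis by simp
    qed
    then have "\<forall>m\<ge>1. c m x \<in> ?U"
      using r_pos by (auto intro!: coeff_in_uniform_span[of "r / 2"])
    then show ?case using uniform_span_add[OF IH(1) x] by simp
  qed
  moreover obtain n where "\<bar>x\<bar> / (r / 2) \<le> real n" using real_arch_simple by blast
  ultimately show ?thesis using r_pos by (simp add: pos_divide_le_eq)
qed

end

text \<open>
  The Cauchy estimates at real base points \<open>x\<close> with \<open>|x| \<le> R\<close> only involve values in one compact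
  rectangle \<open>K\<close> around \<open>[-R, R]\<close>, and on \<open>\<Theta> \<times> K\<close> the jointly continuous extension is bounded.
\<close>

lemma taylor_family_analytic_ensemble:
  fixes f :: "'p::topological_space \<Rightarrow> real \<Rightarrow> real"
  assumes comp: "compact (UNIV :: 'p set)" and "\<rho> > 0" and "analytic_ensemble \<rho> f"
  shows "taylor_family f (\<lambda>m x \<theta>. (deriv ^^ m) (f \<theta>) x / fact m) (\<rho> / 4)"
    and "\<And>x. continuous_on UNIV (\<lambda>\<theta>. f \<theta> x)"
proof -
  obtain F :: "'p \<Rightarrow> complex \<Rightarrow> complex" where
    an: "\<And>\<theta>. F \<theta> analytic_on real_line_nbhd \<rho>" and
    eq: "\<And>\<theta> x. F \<theta> (complex_of_real x) = complex_of_real (f \<theta> x)" and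
    cont: "continuous_on (UNIV \<times> real_line_nbhd \<rho>) (\<lambda>(\<theta>, z). F \<theta> z)"
    using \<open>analytic_ensemble \<rho> f\<close> unfolding analytic_ensemble_def by auto
  have hol: "F \<theta> holomorphic_on real_line_nbhd \<rho>" for \<theta>
    using an analytic_imp_holomorphic by blast
  show "continuous_on UNIV (\<lambda>\<theta>. f \<theta> x)" for x
  proof -
    have "continuous_on UNIV (\<lambda>\<theta>. (\<lambda>(\<theta>, z). F \<theta> z) (\<theta>, complex_of_real x))"
      using of_real_in_real_line_nbhd[OF \<open>\<rho> > 0\<close>]
      by (intro continuous_on_compose2[OF cont]) (auto intro!: continuous_intros)
    then have "continuous_on UNIV (\<lambda>\<theta>. Re (complex_of_real (f \<theta> x)))"
      using eq by (intro continuous_intros) simp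
    then show ?thesis by simp
  qed
  define s where "s = \<rho> / 2"
  have s: "s > 0" "s < \<rho>" using \<open>\<rho> > 0\<close> by (auto simp: s_def)
  show "taylor_family f (\<lambda>m x \<theta>. (deriv ^^ m) (f \<theta>) x / fact m) (\<rho> / 4)"
  proof
    fix R :: real
    define K where "K = cbox (Complex (- R - s) (- s)) (Complex (R + s) s)"
    have K: "z \<in> K \<longleftrightarrow> - R - s \<le> Re z \<and> Re z \<le> R + s \<and> - s \<le> Im z \<and> Im z \<le> s" for z
      by (auto simp: K_def in_cbox_complex_iff)
    have "K \<subseteq> real_line_nbhd \<rho>"
    proof
      fix z assume "z \<in> K"
      have "dist (complex_of_real (Re z)) z = \<bar>Im z\<bar>"
        by (simp add: dist_norm complex_eq_iff cmod_def)
      also have "\<dots> < \<rho>" using \<open>z \<in> K\<close> s unfolding K by linarith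
      finally show "z \<in> real_line_nbhd \<rho>" by (auto simp: real_line_nbhd_def)
    qed
    then have "continuous_on (UNIV \<times> K) (\<lambda>(\<theta>, z). F \<theta> z)"
      by (intro continuous_on_subset[OF cont]) auto
    moreover have "compact ((UNIV :: 'p set) \<times> K)"
      using comp by (intro compact_Times) (auto simp: K_def)
    ultimately have "bounded ((\<lambda>(\<theta>, z). F \<theta> z) ` (UNIV \<times> K))"
      using compact_continuous_image compact_imp_bounded by blast
    then obtain B where B: "B > 0" and
        le_B: "\<forall>w\<in>(\<lambda>(\<theta>, z). F \<theta> z) ` (UNIV \<times> K). norm w \<le> B"
      unfolding bounded_pos by blast
    have FB: "norm (F \<theta> z) \<le> B" if "z \<in> K" for \<theta> z
      using bspec[OF le_B, of "F \<theta> z"] that by auto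
    have "\<bar>f \<theta> (x + h) - (\<Sum>m<N. (deriv ^^ m) (f \<theta>) x / fact m * h ^ m)\<bar>
            \<le> 2 * B * (\<bar>h\<bar> / (2 * (\<rho> / 4))) ^ N"
      if x: "\<bar>x\<bar> \<le> R" and h: "\<bar>h\<bar> \<le> \<rho> / 4" for \<theta> x h N
    proof -
      let ?x = "complex_of_real x" and ?h = "complex_of_real h"
      have sub: "cball ?x s \<subseteq> K"
      proof
        fix z assume "z \<in> cball ?x s"
        then have "norm (z - ?x) \<le> s" by (simp add: dist_norm norm_minus_commute)
        then show "z \<in> K"
          using abs_Re_le_cmod[of "z - ?x"] abs_Im_le_cmod[of "z - ?x"] x by (simp add: K) linarith
      qed
      have "norm (F \<theta> (?x + ?h) - (\<Sum>m<N. (deriv ^^ m) (F \<theta>) ?x / fact m * ?h ^ m))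
              \<le> 2 * B * (norm ?h / s) ^ N"
      proof (rule taylor_remainder_le)
        show "F \<theta> holomorphic_on ball ?x s"
          by (rule holomorphic_on_subset[OF hol])
            (use sub \<open>K \<subseteq> _\<close> ball_subset_cball in blast)
        show "continuous_on (cball ?x s) (F \<theta>)"
          by (rule continuous_on_subset[OF holomorphic_on_imp_continuous_on[OF hol]])
            (use sub \<open>K \<subseteq> _\<close> in blast)
        show "norm (F \<theta> w) \<le> B" if "w \<in> cball ?x s" for w
          using FB sub that by blast
        show "norm ?h \<le> s / 2" using h by (simp add: s_def)
      qed (rule s)
      also have "F \<theta> (?x + ?h) - (\<Sum>m<N. (deriv ^^ m) (F \<theta>) ?x / fact m * ?h ^ m)
          = complex_of_real (f \<theta> (x + h) - (\<Sum>m<N. (deriv ^^ m) (f \<theta>) x / fact m * h ^ m))"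
        using eq[of \<theta> "x + h"]
        by (simp add: higher_deriv_of_real[OF hol open_real_line_nbhd of_real_in_real_line_nbhd[OF \<open>\<rho> > 0\<close>] eq])
      finally show ?thesis by (simp only: norm_of_real) (simp add: s_def)
    qed
    then show "\<exists>M\<ge>0. \<forall>\<theta> x h N. \<bar>x\<bar> \<le> R \<longrightarrow> \<bar>h\<bar> \<le> \<rho> / 4 \<longrightarrow>
        \<bar>f \<theta> (x + h) - (\<Sum>m<N. (deriv ^^ m) (f \<theta>) x / fact m * h ^ m)\<bar>
          \<le> M * (\<bar>h\<bar> / (2 * (\<rho> / 4))) ^ N"
      using B by (intro exI[of _ "2 * B"] conjI allI impI) simp_all
  qed (use \<open>\<rho> > 0\<close> in simp)
qed

section \<open>Square integrable functions\<close>

text \<open>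
  This replaces the triangle inequality of the \<open>L\<^sub>2\<close> norm: it lets all density arguments work with
  integrals of squares, at the price of a factor \<open>2\<close>.
\<close>

lemma power2_diff_le_double: "(a - c)\<^sup>2 \<le> 2 * (a - b)\<^sup>2 + 2 * (b - c)\<^sup>2" for a b c :: real
  using zero_le_power2[of "(a - b) - (b - c)"] by (simp add: power2_eq_square algebra_simps)

lemma L2_diff:
  assumes "g \<in> L2 M" "h \<in> L2 M" shows "(\<lambda>x. g x - h x) \<in> L2 M"
proof -
  have m [measurable]: "g \<in> borel_measurable M" "h \<in> borel_measurable M"
    using assms by (auto simp: L2_def)
  have i: "integrable M (\<lambda>x. (g x)\<^sup>2)" "integrable M (\<lambda>x. (h x)\<^sup>2)"
    using assms by (auto simp: L2_def)
  have "integrable M (\<lambda>x. (g x - h x)\<^sup>2)"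
  proof (rule Bochner_Integration.integrable_bound)
    show "integrable M (\<lambda>x. 2 * (g x)\<^sup>2 + 2 * (h x)\<^sup>2)" using i by simp
    show "AE x in M. norm ((g x - h x)\<^sup>2) \<le> norm (2 * (g x)\<^sup>2 + 2 * (h x)\<^sup>2)"
      using power2_diff_le_double[of _ _ 0] by (intro AE_I2) simp
  qed measurable
  then show ?thesis by (simp add: L2_def)
qed

lemma integral_power2_diff_le_double:
  assumes "g \<in> L2 M" "h \<in> L2 M" "k \<in> L2 M"
  shows "(\<integral>x. (g x - k x)\<^sup>2 \<partial>M) \<le> 2 * (\<integral>x. (g x - h x)\<^sup>2 \<partial>M) + 2 * (\<integral>x. (h x - k x)\<^sup>2 \<partial>M)"
proof -
  have i: "integrable M (\<lambda>x. (g x - k x)\<^sup>2)" "integrable M (\<lambda>x. (g x - h x)\<^sup>2)"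
    "integrable M (\<lambda>x. (h x - k x)\<^sup>2)"
    using L2_diff assms unfolding L2_def by blast+
  have "(\<integral>x. (g x - k x)\<^sup>2 \<partial>M) \<le> (\<integral>x. 2 * (g x - h x)\<^sup>2 + 2 * (h x - k x)\<^sup>2 \<partial>M)"
    using i by (intro integral_mono) (auto intro: power2_diff_le_double)
  then show ?thesis using i by simp
qed

lemma L2_closure_iff:
  "g \<in> L2_closure M S \<longleftrightarrow>
     g \<in> L2 M \<and> (\<forall>\<epsilon>>0. \<exists>h\<in>S \<inter> L2 M. (\<integral>x. (h x - g x)\<^sup>2 \<partial>M) < \<epsilon>)"
proof -
  have "(\<forall>\<epsilon>>0. \<exists>h\<in>S \<inter> L2 M. L2_norm M (\<lambda>x. h x - g x) < \<epsilon>) \<longleftrightarrow>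
        (\<forall>\<epsilon>>0. \<exists>h\<in>S \<inter> L2 M. (\<integral>x. (h x - g x)\<^sup>2 \<partial>M) < \<epsilon>)" (is "?l \<longleftrightarrow> ?r")
  proof
    assume l: ?l
    show ?r
    proof (intro allI impI)
      fix \<epsilon> :: real assume "\<epsilon> > 0"
      then obtain h where "h \<in> S \<inter> L2 M" "L2_norm M (\<lambda>x. h x - g x) < sqrt \<epsilon>"
        using l by (meson real_sqrt_gt_zero)
      then show "\<exists>h\<in>S \<inter> L2 M. (\<integral>x. (h x - g x)\<^sup>2 \<partial>M) < \<epsilon>"
        by (auto simp: L2_norm_def)
    qed
  next
    assume r: ?r
    show ?l
    proof (intro allI impI)
      fix \<epsilon> :: real assume "\<epsilon> > 0"
      then obtain h where h: "h \<in> S \<inter> L2 M" "(\<integral>x. (h x - g x)\<^sup>2 \<partial>M) < \<epsilon>\<^sup>2"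
        using r by (meson zero_less_power)
      then have "L2_norm M (\<lambda>x. h x - g x) < \<epsilon>"
        using \<open>\<epsilon> > 0\<close> unfolding L2_norm_def by (intro real_less_lsqrt) auto
      then show "\<exists>h\<in>S \<inter> L2 M. L2_norm M (\<lambda>x. h x - g x) < \<epsilon>" using h(1) by blast
    qed
  qed
  then show ?thesis by (auto simp: L2_closure_def)
qed

lemma L2_closure_subset_L2: "L2_closure M S \<subseteq> L2 M"
  by (auto simp: L2_closure_def)

text \<open>
  The \<open>L\<^sub>2\<close> closure is idempotent; stated as an inclusion so that closures of different generating
  sets can be compared directly.
\<close>

lemma L2_closure_subset:
  assumes "S \<inter> L2 M \<subseteq> L2_closure M S'"
  shows "L2_closure M S \<subseteq> L2_closure M S'"
proof
  fix g assume "g \<in> L2_closure M S"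
  then have g: "g \<in> L2 M" "\<And>\<epsilon>. \<epsilon> > 0 \<Longrightarrow> \<exists>h\<in>S \<inter> L2 M. (\<integral>x. (h x - g x)\<^sup>2 \<partial>M) < \<epsilon>"
    by (auto simp: L2_closure_iff)
  show "g \<in> L2_closure M S'"
    unfolding L2_closure_iff
  proof (intro conjI allI impI g(1))
    fix \<epsilon> :: real assume "\<epsilon> > 0"
    obtain h where h: "h \<in> S \<inter> L2 M" "(\<integral>x. (h x - g x)\<^sup>2 \<partial>M) < \<epsilon> / 4"
      using g(2)[of "\<epsilon> / 4"] \<open>\<epsilon> > 0\<close> by auto
    then have "h \<in> L2_closure M S'" using assms by blast
    then obtain k where k: "k \<in> S' \<inter> L2 M" "(\<integral>x. (k x - h x)\<^sup>2 \<partial>M) < \<epsilon> / 4"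
      unfolding L2_closure_iff using \<open>\<epsilon> > 0\<close> by (meson divide_pos_pos zero_less_numeral)
    have "(\<integral>x. (k x - g x)\<^sup>2 \<partial>M) < \<epsilon>"
      using integral_power2_diff_le_double[of k M h g] h k g(1) by auto
    then show "\<exists>k\<in>S' \<inter> L2 M. (\<integral>x. (k x - g x)\<^sup>2 \<partial>M) < \<epsilon>" using k(1) by blast
  qed
qed

lemma (in finite_measure) bounded_in_L2:
  assumes [measurable]: "g \<in> borel_measurable M" and "AE x in M. \<bar>g x\<bar> \<le> C"
  shows "g \<in> L2 M"
proof -
  have "AE x in M. norm ((g x)\<^sup>2) \<le> C\<^sup>2"
    using assms(2)
  proof eventually_elim
    case (elim x)
    then show ?case using power_mono[OF elim, of 2] by simp
  qed
  then have "integrable M (\<lambda>x. (g x)\<^sup>2)" by (intro integrable_const_bound) auto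
  then show ?thesis by (simp add: L2_def)
qed

lemma (in finite_measure) Linf_subset_L2: "Linf M \<subseteq> L2 M"
  using bounded_in_L2 by (auto simp: Linf_def)

text \<open>
  The truncations of \<open>g\<close> at height \<open>n\<close> converge to \<open>g\<close> pointwise, and their squared distance to \<open>g\<close> is
  dominated by \<open>g\<^sup>2\<close>.
\<close>

lemma L2_subset_closure_Linf: "L2 M \<subseteq> L2_closure M (Linf M)"
proof
  fix g assume g: "g \<in> L2 M"
  then have [measurable]: "g \<in> borel_measurable M" and int: "integrable M (\<lambda>x. (g x)\<^sup>2)"
    by (auto simp: L2_def)
  define T where "T = (\<lambda>n x. max (- real n) (min (real n) (g x)))"
  have [measurable]: "T n \<in> borel_measurable M" for n unfolding T_def by measurable
  have le: "\<bar>T n x - g x\<bar> \<le> \<bar>g x\<bar>" "\<bar>T n x\<bar> \<le> \<bar>g x\<bar>" "\<bar>T n x\<bar> \<le> real n" for n x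
    unfolding T_def by linarith+
  have T: "T n \<in> Linf M \<inter> L2 M" for n
  proof -
    have "integrable M (\<lambda>x. (T n x)\<^sup>2)"
      using le(2) by (intro Bochner_Integration.integrable_bound[OF int] AE_I2)
        (simp_all add: abs_le_square_iff)
    then show ?thesis using le(3) by (auto simp: Linf_def L2_def)
  qed
  have "(\<lambda>n. \<integral>x. (T n x - g x)\<^sup>2 \<partial>M) \<longlonglongrightarrow> (\<integral>x. 0 \<partial>M)"
  proof (rule integral_dominated_convergence[where w = "\<lambda>x. (g x)\<^sup>2"])
    show "AE x in M. (\<lambda>n. (T n x - g x)\<^sup>2) \<longlonglongrightarrow> 0"
    proof (rule AE_I2, rule tendsto_eventually)
      fix x
      have "\<forall>\<^sub>F n in sequentially. \<bar>g x\<bar> \<le> real n"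
        by (rule eventually_sequentiallyI[of "nat \<lceil>\<bar>g x\<bar>\<rceil>"]) linarith
      then show "\<forall>\<^sub>F n in sequentially. (T n x - g x)\<^sup>2 = 0"
        by eventually_elim (auto simp: T_def)
    qed
    show "AE x in M. norm ((T n x - g x)\<^sup>2) \<le> (g x)\<^sup>2" for n
      using le(1) by (intro AE_I2) (simp add: abs_le_square_iff)
  qed (use int in auto)
  then have lim: "(\<lambda>n. \<integral>x. (T n x - g x)\<^sup>2 \<partial>M) \<longlonglongrightarrow> 0" by simp
  show "g \<in> L2_closure M (Linf M)"
    unfolding L2_closure_iff
  proof (intro conjI allI impI g)
    fix \<epsilon> :: real assume "\<epsilon> > 0"
    then have "\<forall>\<^sub>F n in sequentially. (\<integral>x. (T n x - g x)\<^sup>2 \<partial>M) < \<epsilon>"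
      using lim by (intro order_tendstoD(2)) auto
    then obtain n where "(\<integral>x. (T n x - g x)\<^sup>2 \<partial>M) < \<epsilon>" by (auto simp: eventually_sequentially)
    then show "\<exists>h\<in>Linf M \<inter> L2 M. (\<integral>x. (h x - g x)\<^sup>2 \<partial>M) < \<epsilon>" using T by blast
  qed
qed

lemma (in finite_measure) uniform_span_subset_L2_closure:
  assumes "uniform_span S \<subseteq> L2 M"
  shows "uniform_span S \<subseteq> L2_closure M (fun_span S)"
proof
  fix g assume g: "g \<in> uniform_span S"
  show "g \<in> L2_closure M (fun_span S)"
    unfolding L2_closure_iff
  proof (intro conjI allI impI)
    show "g \<in> L2 M" using g assms by blast
    fix \<epsilon> :: real assume "\<epsilon> > 0"
    \<comment> \<open>A uniform error \<open>\<delta>\<close> costs at most \<open>\<delta>\<^sup>2 m\<close>; dividing by \<open>m + 1\<close> covers the null measure and gives strictness.\<close>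
    define m where "m = measure M (space M)"
    define \<delta> where "\<delta> = sqrt (\<epsilon> / (m + 1))"
    have m: "m \<ge> 0" by (simp add: m_def)
    then have "\<delta> > 0" using \<open>\<epsilon> > 0\<close> by (simp add: \<delta>_def)
    then obtain h where h: "h \<in> fun_span S" "\<And>x. \<bar>h x - g x\<bar> \<le> \<delta>"
      using g unfolding uniform_span_def by (auto dest!: spec[of _ \<delta>])
    have "h \<in> L2 M" using h(1) uniform_span_superset assms by blast
    then have "integrable M (\<lambda>x. (h x - g x)\<^sup>2)"
      using L2_diff[of h M g] g assms by (auto simp: L2_def)
    moreover have "(h x - g x)\<^sup>2 \<le> \<delta>\<^sup>2" for x
      using h(2)[of x] \<open>\<delta> > 0\<close> by (intro abs_le_square_iff[THEN iffD1]) simp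
    ultimately have "(\<integral>x. (h x - g x)\<^sup>2 \<partial>M) \<le> (\<integral>x. \<delta>\<^sup>2 \<partial>M)"
      by (intro integral_mono) auto
    also have "\<dots> = \<epsilon> * (m / (m + 1))" using \<open>\<epsilon> > 0\<close> m by (simp add: \<delta>_def m_def)
    also have "\<dots> < \<epsilon> * 1" using \<open>\<epsilon> > 0\<close> m by (intro mult_strict_left_mono) auto
    finally show "\<exists>h\<in>fun_span S \<inter> L2 M. (\<integral>x. (h x - g x)\<^sup>2 \<partial>M) < \<epsilon>"
      using h(1) \<open>h \<in> L2 M\<close> by auto
  qed
qed

lemma continuous_in_L2:
  fixes g :: "'a::topological_space \<Rightarrow> real"
  assumes "compact (UNIV :: 'a set)" "finite_measure M" "sets M = sets borel" "continuous_on UNIV g"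
  shows "g \<in> L2 M"
proof -
  interpret finite_measure M by fact
  have "g \<in> borel_measurable M"
    using borel_measurable_continuous_onI[OF assms(4)] by (simp add: assms(3) cong: measurable_cong_sets)
  moreover have "bounded (range g)"
    using compact_continuous_image[OF assms(4,1)] compact_imp_bounded by blast
  then obtain C where "\<And>x. \<bar>g x\<bar> \<le> C" by (auto simp: bounded_iff)
  ultimately show ?thesis by (intro bounded_in_L2[of _ C]) auto
qed

section \<open>Reachable functions are uniform limits of combinations of increments\<close>

text \<open>
  Taylor's formula with the constant term only.
\<close>

lemma (in taylor_family) equicontinuous:
  assumes "e > 0"
  shows "\<exists>d>0. \<forall>\<theta> x y. \<bar>x\<bar> \<le> R \<longrightarrow> \<bar>y - x\<bar> \<le> d \<longrightarrow> \<bar>f \<theta> y - f \<theta> x\<bar> \<le> e"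
proof -
  obtain M where M: "M \<ge> 0" and est: "\<forall>\<theta> x h N. \<bar>x\<bar> \<le> R \<longrightarrow> \<bar>h\<bar> \<le> r \<longrightarrow>
      \<bar>f \<theta> (x + h) - (\<Sum>m<N. c m x \<theta> * h ^ m)\<bar> \<le> M * (\<bar>h\<bar> / (2 * r)) ^ N"
    using taylor[of R] by (elim exE conjE)
  define d where "d = min r (2 * r * e / (M + 1))"
  have d: "d > 0" "d \<le> r" "d \<le> 2 * r * e / (M + 1)" using r_pos M \<open>e > 0\<close> by (auto simp: d_def)
  have "\<bar>f \<theta> y - f \<theta> x\<bar> \<le> e" if "\<bar>x\<bar> \<le> R" "\<bar>y - x\<bar> \<le> d" for \<theta> x y
  proof -
    have "\<bar>f \<theta> (x + (y - x)) - (\<Sum>m<1. c m x \<theta> * (y - x) ^ m)\<bar> \<le> M * (\<bar>y - x\<bar> / (2 * r)) ^ 1"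
      using est[rule_format, of x "y - x" \<theta> 1] that d(2) by linarith
    then have "\<bar>f \<theta> y - f \<theta> x\<bar> \<le> M * (\<bar>y - x\<bar> / (2 * r))"
      by (simp add: coeff_0)
    also have "\<dots> \<le> (M + 1) * ((2 * r * e / (M + 1)) / (2 * r))"
      using M that(2) d r_pos by (intro mult_mono divide_right_mono) auto
    also have "\<dots> = e" using M r_pos by simp
    finally show ?thesis .
  qed
  then show ?thesis using d(1) by (intro exI[of _ d] conjI allI impI)
qed

lemma solves_ae_continuous:
  assumes "solves_ae T \<xi> g"
  shows "continuous_on {0..T} \<xi>"
proof -
  have int: "integrable (lebesgue_on {0..T}) g"
    and eq: "\<And>t. t \<in> {0..T} \<Longrightarrow> \<xi> t - \<xi> 0 = integral\<^sup>L (lebesgue_on {0..t}) g"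
    using assms unfolding solves_ae_def by blast+
  have eq': "\<xi> t = \<xi> 0 + integral {0..t} g" if "t \<in> {0..T}" for t
  proof -
    have "integrable (lebesgue_on {0..t}) g"
      using int that by (intro integrable_subinterval[OF int]) auto
    then have "\<xi> t - \<xi> 0 = integral {0..t} g"
      unfolding eq[OF that] by (simp add: lebesgue_integral_eq_integral)
    then show ?thesis by linarith
  qed
  have "g integrable_on {0..T}"
    using int by (intro integrable_on_lebesgue_on) auto
  then have "continuous_on {0..T} (\<lambda>t. \<xi> 0 + integral {0..t} g)"
    by (intro continuous_on_add continuous_on_const indefinite_integral_continuous_1)
  then show ?thesis
    by (rule continuous_on_eq) (rule eq'[symmetric])
qed

text \<open>
  Partition the range of \<open>x\<close>, not the time interval: with \<open>q(t) = \<lfloor>x(t)/d\<rfloor>\<close> the point \<open>d q(t)\<close> is within \<open>d\<close>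
  of \<open>x(t)\<close>, so by equicontinuity \<open>z\<^sup>\<theta>(T)\<close> is uniformly close to \<open>\<integral> f\<^sup>\<theta>(d q(t)) v(t) dt\<close>, which is the finite sum
  of the \<open>f\<^sup>\<theta>(d k) w(k)\<close> where \<open>w(k)\<close> is the integral of \<open>v\<close> over the times with \<open>q(t) = k\<close>. The weights
  \<open>w(k)\<close> add up to \<open>\<integral> v = y(T) = 0\<close>, so \<open>f\<^sup>\<theta>(0)\<close> may be subtracted from each value.
\<close>

lemma (in taylor_family) reachable_in_uniform_span_increments:
  assumes traj: "ensemble_trajectory f T u v x y z" and T: "T > 0" and yT: "y T = 0"
  shows "(\<lambda>\<theta>. z \<theta> T) \<in> uniform_span {\<lambda>\<theta>. f \<theta> x - f \<theta> 0 | x. True}"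
    (is "_ \<in> uniform_span ?D")
  unfolding uniform_span_def
proof (intro CollectI allI impI)
  fix \<epsilon> :: real assume "\<epsilon> > 0"
  let ?L = "lebesgue_on {0..T}"
  have init: "y 0 = 0" "\<And>\<theta>. z \<theta> 0 = 0"
    and xu: "solves_ae T x u" and yv: "solves_ae T y v"
    and zf: "\<And>\<theta>. solves_ae T (z \<theta>) (\<lambda>t. f \<theta> (x t) * v t)"
    using traj by (auto simp: ensemble_trajectory_def)
  have v: "integrable ?L v" and v0: "integral\<^sup>L ?L v = 0"
    using yv T yT init unfolding solves_ae_def by auto
  have fv: "integrable ?L (\<lambda>t. f \<theta> (x t) * v t)" 
    and z: "z \<theta> T = integral\<^sup>L ?L (\<lambda>t. f \<theta> (x t) * v t)" for \<theta>
    using zf[of \<theta>] T init unfolding solves_ae_def by auto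
  have cont: "continuous_on {0..T} x" using solves_ae_continuous[OF xu] .
  then have [measurable]: "x \<in> borel_measurable ?L"
    by (intro continuous_imp_measurable_on_sets_lebesgue) auto
  have [measurable]: "v \<in> borel_measurable ?L" using v by auto
  have "bounded (x ` {0..T})"
    using compact_continuous_image[OF cont] compact_imp_bounded by blast
  then obtain R where "\<forall>t\<in>{0..T}. \<bar>x t\<bar> \<le> R" by (auto simp: bounded_iff simp del: atLeastAtMost_iff)
  then have R: "\<bar>x t\<bar> \<le> R" if "t \<in> {0..T}" for t using that by blast
  define V where "V = integral\<^sup>L ?L (\<lambda>t. \<bar>v t\<bar>)"
  have V: "V \<ge> 0" unfolding V_def by simp
  define e where "e = \<epsilon> / (V + 1)"
  have e: "e > 0" using V \<open>\<epsilon> > 0\<close> by (simp add: e_def)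
  obtain d where d: "d > 0" and
    equi: "\<And>\<theta> x y. \<bar>x\<bar> \<le> R \<Longrightarrow> \<bar>y - x\<bar> \<le> d \<Longrightarrow> \<bar>f \<theta> y - f \<theta> x\<bar> \<le> e"
    using equicontinuous[OF e, of R] by auto
  define q where "q = (\<lambda>t. \<lfloor>x t / d\<rfloor>)"
  have q: "\<bar>d * real_of_int (q t) - x t\<bar> \<le> d" for t
  proof -
    have "real_of_int (q t) \<le> x t / d" "x t / d \<le> real_of_int (q t) + 1"
      unfolding q_def by linarith+
    then show ?thesis using d by (simp add: field_simps abs_le_iff)
  qed
  define I where "I = {\<lfloor>- R / d\<rfloor>..\<lfloor>R / d\<rfloor>}"
  have qI: "q t \<in> I" if "t \<in> {0..T}" for t
  proof -
    have "- R / d \<le> x t / d" "x t / d \<le> R / d"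
      using R[OF that] d by (intro divide_right_mono; simp add: abs_le_iff)+
    then show ?thesis unfolding q_def I_def by (simp only: atLeastAtMost_iff floor_mono)
  qed
  define s where "s = (\<lambda>k t. if q t = k then v t else 0)"
  have [measurable]: "q \<in> measurable ?L (count_space UNIV)"
    unfolding q_def by measurable
  have [measurable]: "s k \<in> borel_measurable ?L" for k
    unfolding s_def by measurable
  have s: "integrable ?L (s k)" for k
    by (rule Bochner_Integration.integrable_bound[OF v]) (auto simp: s_def)
  have sum_s: "(\<Sum>k\<in>I. g k * s k t) = g (q t) * v t" if "t \<in> {0..T}" for g t
    using qI[OF that] by (simp add: s_def I_def if_distrib cong: if_cong)
  define w where "w = (\<lambda>k. integral\<^sup>L ?L (s k))"
  have sum_w: "(\<Sum>k\<in>I. g k * w k) = integral\<^sup>L ?L (\<lambda>t. g (q t) * v t)"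
    and int_q: "integrable ?L (\<lambda>t. g (q t) * v t)" for g
  proof -
    have cong: "integral\<^sup>L ?L (\<lambda>t. \<Sum>k\<in>I. g k * s k t) = integral\<^sup>L ?L (\<lambda>t. g (q t) * v t)"
      "integrable ?L (\<lambda>t. \<Sum>k\<in>I. g k * s k t) = integrable ?L (\<lambda>t. g (q t) * v t)"
      by (rule Bochner_Integration.integral_cong Bochner_Integration.integrable_cong;
          simp add: sum_s)+
    show "(\<Sum>k\<in>I. g k * w k) = integral\<^sup>L ?L (\<lambda>t. g (q t) * v t)"
      unfolding cong(1)[symmetric] w_def using s by simp
    show "integrable ?L (\<lambda>t. g (q t) * v t)"
      unfolding cong(2)[symmetric] using s by simp
  qed
  have w0: "(\<Sum>k\<in>I. w k) = 0" using sum_w[of "\<lambda>_. 1"] v0 by simp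
  let ?h = "\<lambda>\<theta>. \<Sum>k\<in>I. w k * (f \<theta> (d * real_of_int k) - f \<theta> 0)"
  have "?h \<in> fun_span ?D"
  proof -
    have "finite I" by (simp add: I_def)
    then show ?thesis
    proof (induction I rule: finite_induct)
      case (insert k I)
      have "(\<lambda>\<theta>. f \<theta> (d * real_of_int k) - f \<theta> 0) \<in> fun_span ?D" by (auto intro!: fun_span_base)
      from fun_span_add[OF fun_span_scale[OF this] insert.IH] insert.hyps
      show ?case by simp
    qed (simp add: fun_span_0)
  qed
  moreover have "\<bar>?h \<theta> - z \<theta> T\<bar> \<le> \<epsilon>" for \<theta>
  proof -
    have "?h \<theta> = (\<Sum>k\<in>I. f \<theta> (d * real_of_int k) * w k) - (\<Sum>k\<in>I. w k) * f \<theta> 0"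
      by (simp add: sum_distrib_right algebra_simps flip: sum_subtractf)
    also have "\<dots> = integral\<^sup>L ?L (\<lambda>t. f \<theta> (d * real_of_int (q t)) * v t)"
      by (simp add: w0 sum_w)
    finally have "?h \<theta> - z \<theta> T =
        integral\<^sup>L ?L (\<lambda>t. f \<theta> (d * real_of_int (q t)) * v t - f \<theta> (x t) * v t)"
      using fv int_q[of "\<lambda>k. f \<theta> (d * real_of_int k)"] by (simp add: z)
    also have "\<bar>\<dots>\<bar> \<le> integral\<^sup>L ?L (\<lambda>t. e * \<bar>v t\<bar>)"
    proof (rule integral_abs_bound_integral)
      show "integrable ?L (\<lambda>t. f \<theta> (d * real_of_int (q t)) * v t - f \<theta> (x t) * v t)"
        using fv int_q[of "\<lambda>k. f \<theta> (d * real_of_int k)"] by simp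
      show "integrable ?L (\<lambda>t. e * \<bar>v t\<bar>)" using v by simp
      fix t assume "t \<in> space ?L"
      then have "\<bar>f \<theta> (d * real_of_int (q t)) - f \<theta> (x t)\<bar> \<le> e"
        using equi[OF R q] by simp
      then have "\<bar>f \<theta> (d * real_of_int (q t)) - f \<theta> (x t)\<bar> * \<bar>v t\<bar> \<le> e * \<bar>v t\<bar>"
        by (rule mult_right_mono) simp
      then show "\<bar>f \<theta> (d * real_of_int (q t)) * v t - f \<theta> (x t) * v t\<bar> \<le> e * \<bar>v t\<bar>"
        by (simp add: abs_mult flip: left_diff_distrib)
    qed
    also have "\<dots> = \<epsilon> * (V / (V + 1))" by (simp add: V_def[symmetric] e_def)
    also have "\<dots> \<le> \<epsilon> * 1" using V \<open>\<epsilon> > 0\<close> by (intro mult_left_mono) auto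
    finally show ?thesis by simp
  qed
  ultimately show "\<exists>h\<in>fun_span ?D. \<forall>\<theta>. \<bar>h \<theta> - z \<theta> T\<bar> \<le> \<epsilon>"
    by (intro bexI[of _ ?h] allI)
qed

section \<open>Combinations of increments are reachable\<close>

text \<open>
  Loops are concatenated below. Letting the time interval start anywhere makes this a matter of
  joining functions on adjacent intervals, without translating integrals.
\<close>

definition solves_between :: "real \<Rightarrow> real \<Rightarrow> (real \<Rightarrow> real) \<Rightarrow> (real \<Rightarrow> real) \<Rightarrow> bool" where
  "solves_between a b \<xi> g \<longleftrightarrow> integrable (lebesgue_on {a..b}) g \<and>
     (\<forall>t\<in>{a..b}. \<xi> t - \<xi> a = integral\<^sup>L (lebesgue_on {a..t}) g)"

lemma solves_between_0: "solves_between 0 T = solves_ae T"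
  by (simp add: solves_between_def solves_ae_def fun_eq_iff)

lemma solves_between_const: "solves_between a b (\<lambda>t. p + k * (t - a)) (\<lambda>_. k)"
  by (auto simp: solves_between_def measure_restrict_space)

lemma solves_between_add_const:
  "solves_between a b \<xi> g \<Longrightarrow> solves_between a b (\<lambda>t. p + \<xi> t) g"
  by (simp add: solves_between_def)

lemma solves_between_join:
  assumes "a \<le> b" "b \<le> c" and 1: "solves_between a b \<xi> g" and 2: "solves_between b c \<eta> h"
    and eq: "\<xi> b = \<eta> b"
  shows "solves_between a c (\<lambda>t. if t \<le> b then \<xi> t else \<eta> t) (\<lambda>t. if t \<le> b then g t else h t)"
    (is "solves_between a c ?\<zeta> ?k")
proof -
  have g: "integrable (lebesgue_on {a..b}) g" and h: "integrable (lebesgue_on {b..c}) h"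
    using 1 2 by (auto simp: solves_between_def)
  have k1: "integrable (lebesgue_on {a..b}) ?k"
    using g by (rule Bochner_Integration.integrable_cong[THEN iffD1, rotated 2]) auto
  have "set_integrable lebesgue {b..c} h"
    using h by (simp add: integrable_restrict_space set_integrable_def)
  then have "set_integrable lebesgue {b<..c} h" by (rule set_integrable_subset) auto
  then have "set_integrable lebesgue {b<..c} ?k"
    by (rule set_integrable_cong[THEN iffD1, rotated 3]) auto
  moreover have "set_integrable lebesgue {a..b} ?k"
    using k1 by (simp add: integrable_restrict_space set_integrable_def)
  ultimately have "set_integrable lebesgue ({a..b} \<union> {b<..c}) ?k"
    by (intro set_integrable_Un) auto
  moreover have "{a..b} \<union> {b<..c} = {a..c}" using assms by auto
  ultimately have k: "integrable (lebesgue_on {a..c}) ?k"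
    by (simp add: integrable_restrict_space set_integrable_def)
  have "?\<zeta> t - ?\<zeta> a = integral\<^sup>L (lebesgue_on {a..t}) ?k" if t: "t \<in> {a..c}" for t
  proof (cases "t \<le> b")
    case True
    have "integral\<^sup>L (lebesgue_on {a..t}) ?k = integral\<^sup>L (lebesgue_on {a..t}) g"
      using True by (intro Bochner_Integration.integral_cong) auto
    then show ?thesis using 1 True t \<open>a \<le> b\<close> by (simp add: solves_between_def)
  next
    case False
    have k': "integrable (lebesgue_on {a..t}) ?k"
      using t by (intro integrable_subinterval[OF k]) auto
    have h': "integrable (lebesgue_on {b..t}) h"
      using t by (intro integrable_subinterval[OF h]) auto
    have "integral\<^sup>L (lebesgue_on {a..t}) ?k = integral {a..t} ?k"
      using k' by (simp add: lebesgue_integral_eq_integral)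
    also have "\<dots> = integral {a..b} ?k + integral {b..t} ?k"
      using integrable_on_lebesgue_on[OF k'] False \<open>a \<le> b\<close>
      by (intro Henstock_Kurzweil_Integration.integral_combine[symmetric]) auto
    also have "integral {a..b} ?k = integral {a..b} g"
      by (rule Henstock_Kurzweil_Integration.integral_cong) auto
    also have "integral {b..t} ?k = integral {b..t} h"
      by (rule integral_spike[of "{b}"]) auto
    also have "integral {a..b} g = \<xi> b - \<xi> a"
      using 1 g \<open>a \<le> b\<close> by (simp add: solves_between_def lebesgue_integral_eq_integral)
    also have "integral {b..t} h = \<eta> t - \<eta> b"
      using 2 h' t False by (simp add: solves_between_def lebesgue_integral_eq_integral)
    finally show ?thesis using eq False \<open>a \<le> b\<close> by simp
  qed
  then show ?thesis using k by (simp add: solves_between_def)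
qed

text \<open>
  Bounded Borel controls on \<open>[a,b]\<close> move \<open>(x,y)\<close> from \<open>p\<close> to \<open>q\<close> and increase \<open>z\<^sup>\<theta>\<close> by \<open>g \<theta>\<close>. Such
  controls are stable under joining and square integrable on any bounded interval. There is no recursion; an
  inductive predicate provides the introduction and elimination rules for the many existential witnesses.
\<close>

inductive steers ::
  "('p \<Rightarrow> real \<Rightarrow> real) \<Rightarrow> real \<Rightarrow> real \<Rightarrow> real \<times> real \<Rightarrow> real \<times> real \<Rightarrow> ('p \<Rightarrow> real) \<Rightarrow> bool"
  for f a b p q g where
  "steers f a b p q g"
  if "u \<in> borel_measurable borel" "v \<in> borel_measurable borel"
    and "\<forall>t. \<bar>u t\<bar> \<le> C" "\<forall>t. \<bar>v t\<bar> \<le> C"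
    and "solves_between a b x u" "solves_between a b y v"
    and "\<forall>\<theta>. solves_between a b (z \<theta>) (\<lambda>t. f \<theta> (x t) * v t)"
    and "(x a, y a) = p" "(x b, y b) = q" "\<forall>\<theta>. z \<theta> a = 0" "\<forall>\<theta>. z \<theta> b = g \<theta>"

lemma steers_join:
  assumes "a \<le> b" "b \<le> c" "steers f a b p q g" "steers f b c q s h"
  shows "steers f a c p s (\<lambda>\<theta>. g \<theta> + h \<theta>)"
proof -
  obtain u v x y z C where 1: "u \<in> borel_measurable borel" "v \<in> borel_measurable borel"
      "\<forall>t. \<bar>u t\<bar> \<le> C" "\<forall>t. \<bar>v t\<bar> \<le> C" "solves_between a b x u" "solves_between a b y v"
      "\<forall>\<theta>. solves_between a b (z \<theta>) (\<lambda>t. f \<theta> (x t) * v t)"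
      "(x a, y a) = p" "(x b, y b) = q" "\<forall>\<theta>. z \<theta> a = 0" "\<forall>\<theta>. z \<theta> b = g \<theta>"
    using assms(3) by (rule steers.cases)
  note 1 = 1[rule_format]
  obtain u' v' x' y' z' C' where 2: "u' \<in> borel_measurable borel" "v' \<in> borel_measurable borel"
      "\<forall>t. \<bar>u' t\<bar> \<le> C'" "\<forall>t. \<bar>v' t\<bar> \<le> C'" "solves_between b c x' u'" "solves_between b c y' v'"
      "\<forall>\<theta>. solves_between b c (z' \<theta>) (\<lambda>t. f \<theta> (x' t) * v' t)"
      "(x' b, y' b) = q" "(x' c, y' c) = s" "\<forall>\<theta>. z' \<theta> b = 0" "\<forall>\<theta>. z' \<theta> c = h \<theta>"
    using assms(4) by (rule steers.cases)
  note 2 = 2[rule_format]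
  let ?j = "\<lambda>k l t. if t \<le> b then k t else l t"
  have m: "?j k l \<in> borel_measurable borel" if [measurable]: "k \<in> borel_measurable borel" "l \<in> borel_measurable borel"
    for k l :: "real \<Rightarrow> real" by measurable
  have z: "solves_between a c (?j (z \<theta>) (\<lambda>t. g \<theta> + z' \<theta> t)) (\<lambda>t. f \<theta> (?j x x' t) * ?j v v' t)" for \<theta>
  proof -
    have "solves_between a c (?j (z \<theta>) (\<lambda>t. g \<theta> + z' \<theta> t))
            (?j (\<lambda>t. f \<theta> (x t) * v t) (\<lambda>t. f \<theta> (x' t) * v' t))"
      by (rule solves_between_join[OF assms(1,2) 1(7) solves_between_add_const[OF 2(7)]])
        (simp add: 1 2)
    moreover have "?j (\<lambda>t. f \<theta> (x t) * v t) (\<lambda>t. f \<theta> (x' t) * v' t) = (\<lambda>t. f \<theta> (?j x x' t) * ?j v v' t)"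
      by auto
    ultimately show ?thesis by simp
  qed
  have eq: "x b = x' b" "y b = y' b" using 1(9) 2(8) by auto
  have end_eq: "?j k l c = l c" if "k b = l b" for k l :: "real \<Rightarrow> real"
    using that assms(2) by (cases "c = b") auto
  show ?thesis
  proof (rule steers.intros)
    show "?j u u' \<in> borel_measurable borel" "?j v v' \<in> borel_measurable borel"
      using m 1(1,2) 2(1,2) by blast+
    show "\<forall>t. \<bar>?j u u' t\<bar> \<le> max C C'" "\<forall>t. \<bar>?j v v' t\<bar> \<le> max C C'"
      using 1(3,4) 2(3,4) by (simp_all add: le_max_iff_disj)
    show "solves_between a c (?j x x') (?j u u')" "solves_between a c (?j y y') (?j v v')"
      using solves_between_join[OF assms(1,2) 1(5) 2(5)] solves_between_join[OF assms(1,2) 1(6) 2(6)] eq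
      by auto
    show "(?j x x' a, ?j y y' a) = p" using 1(8) assms(1) by simp
    show "(?j x x' c, ?j y y' c) = s" using 2(9) end_eq eq by simp
    show "\<forall>\<theta>. ?j (z \<theta>) (\<lambda>t. g \<theta> + z' \<theta> t) a = 0" using 1(10) assms(1) by simp
    show "\<forall>\<theta>. ?j (z \<theta>) (\<lambda>t. g \<theta> + z' \<theta> t) c = g \<theta> + h \<theta>"
    proof
      fix \<theta>
      show "?j (z \<theta>) (\<lambda>t. g \<theta> + z' \<theta> t) c = g \<theta> + h \<theta>"
        using end_eq[of "z \<theta>" "\<lambda>t. g \<theta> + z' \<theta> t"] 1(11) 2(10,11) by simp
    qed
    show "\<forall>\<theta>. solves_between a c (?j (z \<theta>) (\<lambda>t. g \<theta> + z' \<theta> t)) (\<lambda>t. f \<theta> (?j x x' t) * ?j v v' t)"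
      using z by (rule allI)
  qed
qed

lemma steers_horizontal:
  assumes "a < b" shows "steers f a b (p, y) (q, y) (\<lambda>\<theta>. 0)"
proof (rule steers.intros)
  show "solves_between a b (\<lambda>t. p + (q - p) / (b - a) * (t - a)) (\<lambda>_. (q - p) / (b - a))"
    by (rule solves_between_const)
  show "solves_between a b (\<lambda>_. y) (\<lambda>_. 0)"
    using solves_between_const[of a b y 0] by simp
  show "\<forall>\<theta>. solves_between a b ((\<lambda>_ _. 0) \<theta>) (\<lambda>t. f \<theta> (p + (q - p) / (b - a) * (t - a)) * 0)"
    using solves_between_const[of a b 0 0] by simp
  show "\<forall>t::real. \<bar>(q - p) / (b - a)\<bar> \<le> \<bar>(q - p) / (b - a)\<bar>" by simp
qed (use assms in simp_all)

lemma steers_vertical: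
  assumes "a < b" shows "steers f a b (x, p) (x, q) (\<lambda>\<theta>. f \<theta> x * (q - p))"
proof (rule steers.intros)
  show "solves_between a b (\<lambda>_. x) (\<lambda>_. 0)"
    using solves_between_const[of a b x 0] by simp
  show "solves_between a b (\<lambda>t. p + (q - p) / (b - a) * (t - a)) (\<lambda>_. (q - p) / (b - a))"
    by (rule solves_between_const)
  show "\<forall>\<theta>. solves_between a b ((\<lambda>\<theta> t. 0 + f \<theta> x * ((q - p) / (b - a)) * (t - a)) \<theta>)
          (\<lambda>_. f \<theta> x * ((q - p) / (b - a)))"
    by (intro allI solves_between_const)
  show "\<forall>t::real. \<bar>(q - p) / (b - a)\<bar> \<le> \<bar>(q - p) / (b - a)\<bar>" by simp
qed (use assms in simp_all)

text \<open>
  Only the sides on which \<open>y\<close> moves contribute to \<open>z\<^sup>\<theta>\<close>: \<open>k f\<^sup>\<theta>(x)\<close> on the way up, \<open>- k f\<^sup>\<theta>(0)\<close> on the way down.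
\<close>

lemma steers_rectangle:
  assumes "a < b" shows "steers f a b (0, 0) (0, 0) (\<lambda>\<theta>. k * (f \<theta> x - f \<theta> 0))"
proof -
  define l m n where "l = a + (b - a) / 4" and "m = a + (b - a) / 2" and "n = a + 3 * (b - a) / 4"
  have lmn: "a < l" "l < m" "m < n" "n < b" using assms by (auto simp: l_def m_def n_def field_simps)
  have "steers f a m (0, 0) (x, k) (\<lambda>\<theta>. 0 + f \<theta> x * (k - 0))"
    using lmn by (intro steers_join[OF _ _ steers_horizontal[of a l] steers_vertical[of l m]]) auto
  moreover have "steers f m b (x, k) (0, 0) (\<lambda>\<theta>. 0 + f \<theta> 0 * (0 - k))"
    using lmn by (intro steers_join[OF _ _ steers_horizontal[of m n] steers_vertical[of n b]]) auto
  ultimately have "steers f a b (0, 0) (0, 0)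
      (\<lambda>\<theta>. (0 + f \<theta> x * (k - 0)) + (0 + f \<theta> 0 * (0 - k)))"
    by (rule steers_join[rotated 2]) (use lmn in simp_all)
  then show ?thesis by (simp add: algebra_simps)
qed

text \<open>
  The time interval is halved for each summand: one rectangle in the first half, the remaining
  combination in the second. This is why the claim has to be proved for all intervals at once.
\<close>

lemma steers_fun_span_increments:
  assumes "g \<in> fun_span {\<lambda>\<theta>. f \<theta> x - f \<theta> 0 | x. True}" "a < b"
  shows "steers f a b (0, 0) (0, 0) g"
  using assms
proof (induction arbitrary: a b rule: fun_span_induct)
  case zero
  then show ?case using steers_rectangle[of a b f 0] by simp
next
  case (add k h g)
  then obtain x where h: "h = (\<lambda>\<theta>. f \<theta> x - f \<theta> 0)" by auto
  define m where "m = (a + b) / 2"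
  have m: "a < m" "m < b" using add.prems by (auto simp: m_def)
  have "steers f a m (0, 0) (0, 0) (\<lambda>\<theta>. k * h \<theta>)"
    unfolding h by (rule steers_rectangle[OF m(1)])
  moreover have "steers f m b (0, 0) (0, 0) g"
    using add.IH m(2) by blast
  ultimately show ?case using m by (intro steers_join[of a m]) auto
qed

lemma steers_ensemble_trajectory:
  assumes "steers f 0 T (0, 0) (0, 0) g"
  shows "\<exists>u\<in>L2 (lebesgue_on {0..T}). \<exists>v\<in>L2 (lebesgue_on {0..T}). \<exists>x y z.
           ensemble_trajectory f T u v x y z \<and> x T = 0 \<and> y T = 0 \<and> (\<forall>\<theta>. z \<theta> T = g \<theta>)"
proof -
  obtain u v x y z C where *: "u \<in> borel_measurable borel" "v \<in> borel_measurable borel"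
      "\<forall>t. \<bar>u t\<bar> \<le> C" "\<forall>t. \<bar>v t\<bar> \<le> C" "solves_between 0 T x u" "solves_between 0 T y v"
      "\<forall>\<theta>. solves_between 0 T (z \<theta>) (\<lambda>t. f \<theta> (x t) * v t)"
      "(x 0, y 0) = (0, 0)" "(x T, y T) = (0, 0)" "\<forall>\<theta>. z \<theta> 0 = 0" "\<forall>\<theta>. z \<theta> T = g \<theta>"
    using assms by (rule steers.cases)
  interpret finite_measure "lebesgue_on {0..T}" by (rule finite_measure_lebesgue_on) simp
  have "w \<in> L2 (lebesgue_on {0..T})" if "w \<in> borel_measurable borel" "\<forall>t. \<bar>w t\<bar> \<le> C" for w
  proof (rule bounded_in_L2[of _ C])
    show "w \<in> borel_measurable (lebesgue_on {0..T})"
      using that(1) by (intro measurable_restrict_space1 measurable_completion) simp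
  qed (use that(2) in simp)
  then have "u \<in> L2 (lebesgue_on {0..T})" "v \<in> L2 (lebesgue_on {0..T})" using *(1-4) by blast+
  moreover have "ensemble_trajectory f T u v x y z"
    using * by (simp add: ensemble_trajectory_def solves_between_0)
  ultimately show ?thesis using * by blast
qed

section \<open>The controllability criterion\<close>

theorem theorem3:
  fixes \<mu> :: "'p::t2_space measure"
    and f :: "'p \<Rightarrow> real \<Rightarrow> real"
    and \<rho> :: real
  assumes "compact (UNIV :: 'p set)"
    and "separable_space (euclidean :: 'p topology)"
    and "sets \<mu> = sets borel"
    and "finite_measure \<mu>"
    and "\<rho> > 0"
    and "analytic_ensemble \<rho> f"
  shows "(\<forall>T>0. approx_controllable \<mu> f T) \<longleftrightarrow>
         L2_closure \<mu> (fun_span {taylor_coeff f m | m. m \<ge> 1}) = L2 \<mu>"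
proof -
  define c where "c = (\<lambda>m x \<theta>. (deriv ^^ m) (f \<theta>) x / fact m)"
  interpret taylor_family f c "\<rho> / 4"
    unfolding c_def using taylor_family_analytic_ensemble(1)[OF assms(1,5,6)] .
  interpret finite_measure \<mu> by fact
  define A where "A = {taylor_coeff f m | m. m \<ge> 1}"
  define D where "D = {\<lambda>\<theta>. f \<theta> x - f \<theta> 0 | x. True}"
  have A_eq: "A = {c m 0 | m. m \<ge> 1}"
    unfolding A_def c_def taylor_coeff_def[abs_def] ..
  have A_D: "fun_span A \<subseteq> uniform_span D"
    unfolding A_eq D_def
    by (intro fun_span_subset_uniform_span) (use coeff_in_uniform_span_increments in blast)
  have D_A: "uniform_span D \<subseteq> uniform_span A"
  proof
    fix g assume g: "g \<in> uniform_span D"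
    have "fun_span D \<subseteq> uniform_span A"
      unfolding A_eq D_def
      by (intro fun_span_subset_uniform_span) (use increment_in_uniform_span_coeffs in blast)
    with g show "g \<in> uniform_span A"
      by (intro uniform_span_closed) (fastforce simp: uniform_span_def[of D])
  qed
  have cont_D: "continuous_on UNIV g" if "g \<in> uniform_span D" for g
    by (rule continuous_on_uniform_span[OF _ that])
      (auto simp: D_def intro!: continuous_intros taylor_family_analytic_ensemble(2)[OF assms(1,5,6)])
  have cont_A: "continuous_on UNIV g" if "g \<in> uniform_span A" for g
    by (rule continuous_on_uniform_span[OF _ that])
      (use A_D fun_span_base cont_D in blast)
  have L2_A: "uniform_span A \<subseteq> L2 \<mu>" and L2_D: "uniform_span D \<subseteq> L2 \<mu>"
    using continuous_in_L2[OF assms(1,4,3)] cont_A cont_D by auto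
  show ?thesis
    unfolding A_def[symmetric]
  proof
    assume "\<forall>T>0. approx_controllable \<mu> f T"
    then have ctrl: "approx_controllable \<mu> f 1" by simp
    have "Linf \<mu> \<subseteq> L2_closure \<mu> (uniform_span A)"
    proof
      fix g assume g: "g \<in> Linf \<mu>"
      show "g \<in> L2_closure \<mu> (uniform_span A)"
        unfolding L2_closure_iff
      proof (intro conjI allI impI)
        show "g \<in> L2 \<mu>" using g Linf_subset_L2 by blast
        fix \<epsilon> :: real assume "\<epsilon> > 0"
        then obtain u v x y z where traj: "ensemble_trajectory f 1 u v x y z" "y 1 = 0"
          and le: "(\<integral>\<theta>. (z \<theta> 1 - g \<theta>)\<^sup>2 \<partial>\<mu>) \<le> \<epsilon> / 2"
          using ctrl g unfolding approx_controllable_def by (meson half_gt_zero)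
        have "(\<lambda>\<theta>. z \<theta> 1) \<in> uniform_span A"
          using reachable_in_uniform_span_increments[OF traj(1) _ traj(2)] D_A unfolding D_def by auto
        then show "\<exists>h\<in>uniform_span A \<inter> L2 \<mu>. (\<integral>\<theta>. (h \<theta> - g \<theta>)\<^sup>2 \<partial>\<mu>) < \<epsilon>"
          using le \<open>\<epsilon> > 0\<close> L2_A by (intro bexI[of _ "\<lambda>\<theta>. z \<theta> 1"]) auto
      qed
    qed
    also have "L2_closure \<mu> (uniform_span A) \<subseteq> L2_closure \<mu> (fun_span A)"
      using uniform_span_subset_L2_closure[OF L2_A] by (intro L2_closure_subset) auto
    finally have "L2_closure \<mu> (Linf \<mu>) \<subseteq> L2_closure \<mu> (fun_span A)"
      by (intro L2_closure_subset) auto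
    then show "L2_closure \<mu> (fun_span A) = L2 \<mu>"
      using L2_subset_closure_Linf L2_closure_subset_L2 by blast
  next
    assume dense: "L2_closure \<mu> (fun_span A) = L2 \<mu>"
    have "L2_closure \<mu> (fun_span A) \<subseteq> L2_closure \<mu> (fun_span D)"
      using uniform_span_subset_L2_closure[OF L2_D] A_D by (intro L2_closure_subset) auto
    then have D: "L2 \<mu> \<subseteq> L2_closure \<mu> (fun_span D)" using dense by simp
    show "\<forall>T>0. approx_controllable \<mu> f T"
      unfolding approx_controllable_def
    proof (intro allI impI ballI)
      fix T :: real and g and \<epsilon> :: real
      assume "T > 0" "g \<in> Linf \<mu>" "\<epsilon> > 0"
      then have g: "g \<in> L2 \<mu>" "g \<in> L2_closure \<mu> (fun_span D)" using Linf_subset_L2 D by auto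
      then obtain h where h: "h \<in> fun_span D" "h \<in> L2 \<mu>" "(\<integral>\<theta>. (h \<theta> - g \<theta>)\<^sup>2 \<partial>\<mu>) < \<epsilon>"
        using \<open>\<epsilon> > 0\<close> unfolding L2_closure_iff by blast
      have "steers f 0 T (0, 0) (0, 0) h"
        using steers_fun_span_increments h(1) \<open>T > 0\<close> unfolding D_def by blast
      from steers_ensemble_trajectory[OF this]
      obtain u v x y z where "u \<in> L2 (lebesgue_on {0..T})" "v \<in> L2 (lebesgue_on {0..T})"
          "ensemble_trajectory f T u v x y z" "x T = 0" "y T = 0" "\<And>\<theta>. z \<theta> T = h \<theta>"
        by blast
      then show "\<exists>u\<in>L2 (lebesgue_on {0..T}). \<exists>v\<in>L2 (lebesgue_on {0..T}). \<exists>x y z.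
          ensemble_trajectory f T u v x y z \<and> x T = 0 \<and> y T = 0 \<and>
          (\<lambda>\<theta>. z \<theta> T - g \<theta>) \<in> L2 \<mu> \<and> integral\<^sup>L \<mu> (\<lambda>\<theta>. (z \<theta> T - g \<theta>)\<^sup>2) \<le> \<epsilon>"
        using h(3) L2_diff[OF h(2) g(1)]
        by (rule_tac bexI[of _ u], rule_tac bexI[of _ v], rule_tac exI[of _ x], rule_tac exI[of _ y],
            rule_tac exI[of _ z]) simp_all
    qed
  qed
qed

end
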